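(* Let $n\ge1$, let $\lambda$ be a partition of $n$, let $T_i,T_j$ be standard Young tableaux of shape $\lambda$, and let $s\in S_n$. Let $y^s_{ji}$ denote the coefficient of $s$ in the element $p_{ji}=P_j\,\sigma_{ji}\,N_i$ of the group algebra of $S_n$ (over a field of characteristic $0$). The following procedure correctly computes $y_{ji}^s$. Let $T_s$ be the tableau obtained from $T_i$ by replacing each symbol $x$ by $s(x)$. (1) If some two symbols lying in the same column of $T_s$ lie in the same row of $T_j$, the output is $0$. (2) Otherwise, for each column of $T_s$, let $(a_1,\dots,a_c)$ be the sequence of its symbols read from top to bottom, and let $(b_1,\dots,b_c)$ be the same symbols ordered by increasing index of the row they occupy in $T_j$; consider the permutation $a_r\mapsto b_r$ of these symbols. Let $k$ be the sum, over all columns of $T_s$ and over all cycles of the corresponding permutation, of $(l-1)$, where $l$ is the length of the cycle. The output is $1-2\,(k \bmod 2)$. That is, $y_{ji}^s$ equals the output of this procedure.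
   Context: Permutations are bijections of $\{1,\dots,n\}$, and the product $st$ in $S_n$ is composition of functions, $(st)(x)=s(t(x))$. A tableau of shape $\lambda$ is a filling of the Young frame of $\lambda$ by $1,\dots,n$, each used once; it is standard if rows and columns increase. $P_j$ is the sum of all permutations preserving each row of $T_j$ as a set of symbols; $N_i=\sum_v\pi(v)\,v$ over all permutations $v$ preserving each column of $T_i$ as a set of symbols, with $\pi(v)=+1$ for even and $-1$ for odd $v$. $\sigma_{ji}$ is the permutation such that replacing each symbol $x$ of $T_i$ by $\sigma_{ji}(x)$ yields $T_j$; it satisfies $N_j\sigma_{ji}=\sigma_{ji}N_i$ and $P_j\sigma_{ji}=\sigma_{ji}P_i$. *)

theory Defs
  imports "HOL-Algebra.Sym_Groups" "HOL-Combinatorics.Orbits"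
begin

text \<open>
  An element of the group algebra of a finite group is represented by its coefficient function;
  all elements formed below have zero coefficients outside the carrier.
\<close>

definition ga_of :: "'g \<Rightarrow> 'g \<Rightarrow> 'a::field_char_0"
  where "ga_of g = (\<lambda>x. if x = g then 1 else 0)"

definition ga_mult ::
    "('g, 'm) monoid_scheme \<Rightarrow> ('g \<Rightarrow> 'a) \<Rightarrow> ('g \<Rightarrow> 'a) \<Rightarrow> 'g \<Rightarrow> 'a::field_char_0"
  where "ga_mult G f g =
    (\<lambda>x. \<Sum>u\<in>carrier G. \<Sum>v\<in>{v \<in> carrier G. u \<otimes>\<^bsub>G\<^esub> v = x}. f u * g v)"

definition is_partition :: "nat list \<Rightarrow> nat \<Rightarrow> bool"
  where "is_partition lam n \<longleftrightarrow>
    sorted_wrt (\<ge>) lam \<and> (\<forall>x\<in>set lam. 0 < x) \<and> sum_list lam = n"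

text \<open>
  Boxes are pairs (row, column), counted from 0; the symbols are 1, ..., n.
  The values of a tableau outside the frame are arbitrary and never used.
\<close>

definition frame :: "nat list \<Rightarrow> (nat \<times> nat) set"
  where "frame lam = {(r, c). r < length lam \<and> c < lam ! r}"

type_synonym tableau = "nat \<times> nat \<Rightarrow> nat"

definition is_tableau :: "nat \<Rightarrow> nat list \<Rightarrow> tableau \<Rightarrow> bool"
  where "is_tableau n lam T \<longleftrightarrow> bij_betw T (frame lam) {1..n}"

definition standard_tableau :: "nat \<Rightarrow> nat list \<Rightarrow> tableau \<Rightarrow> bool"
  where "standard_tableau n lam T \<longleftrightarrow> is_tableau n lam T \<and>
    (\<forall>r c c'. (r, c) \<in> frame lam \<and> (r, c') \<in> frame lam \<and> c < c' \<longrightarrow> T (r, c) < T (r, c')) \<and>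
    (\<forall>r r' c. (r, c) \<in> frame lam \<and> (r', c) \<in> frame lam \<and> r < r' \<longrightarrow> T (r, c) < T (r', c))"

definition row_symbols :: "nat list \<Rightarrow> tableau \<Rightarrow> nat \<Rightarrow> nat set"
  where "row_symbols lam T r = {T (r, c) | c. (r, c) \<in> frame lam}"

definition col_symbols :: "nat list \<Rightarrow> tableau \<Rightarrow> nat \<Rightarrow> nat set"
  where "col_symbols lam T c = {T (r, c) | r. (r, c) \<in> frame lam}"

definition row_perms :: "nat \<Rightarrow> nat list \<Rightarrow> tableau \<Rightarrow> (nat \<Rightarrow> nat) set"
  where "row_perms n lam T =
    {p \<in> carrier (sym_group n). \<forall>r. p ` row_symbols lam T r = row_symbols lam T r}"

definition col_perms :: "nat \<Rightarrow> nat list \<Rightarrow> tableau \<Rightarrow> (nat \<Rightarrow> nat) set"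
  where "col_perms n lam T =
    {v \<in> carrier (sym_group n). \<forall>c. v ` col_symbols lam T c = col_symbols lam T c}"

definition P_elem :: "nat \<Rightarrow> nat list \<Rightarrow> tableau \<Rightarrow> (nat \<Rightarrow> nat) \<Rightarrow> 'a::field_char_0"
  where "P_elem n lam T = (\<lambda>s. \<Sum>p\<in>row_perms n lam T. ga_of p s)"

definition N_elem :: "nat \<Rightarrow> nat list \<Rightarrow> tableau \<Rightarrow> (nat \<Rightarrow> nat) \<Rightarrow> 'a::field_char_0"
  where "N_elem n lam T = (\<lambda>s. \<Sum>v\<in>col_perms n lam T. of_int (sign v) * ga_of v s)"

text \<open>The permutation carrying the first tableau to the second.\<close>

definition tableau_perm :: "nat \<Rightarrow> nat list \<Rightarrow> tableau \<Rightarrow> tableau \<Rightarrow> nat \<Rightarrow> nat"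
  where "tableau_perm n lam Ti Tj =
    (THE p. p \<in> carrier (sym_group n) \<and> (\<forall>b\<in>frame lam. p (Ti b) = Tj b))"

definition p_elem ::
    "nat \<Rightarrow> nat list \<Rightarrow> tableau \<Rightarrow> tableau \<Rightarrow> (nat \<Rightarrow> nat) \<Rightarrow> 'a::field_char_0"
  where "p_elem n lam Tj Ti =
    ga_mult (sym_group n)
      (ga_mult (sym_group n) (P_elem n lam Tj) (ga_of (tableau_perm n lam Ti Tj)))
      (N_elem n lam Ti)"

definition row_index :: "nat list \<Rightarrow> tableau \<Rightarrow> nat \<Rightarrow> nat"
  where "row_index lam T x = (THE r. x \<in> row_symbols lam T r)"

definition col_list :: "nat list \<Rightarrow> tableau \<Rightarrow> nat \<Rightarrow> nat list"
  where "col_list lam T c =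
    map (\<lambda>r. T (r, c)) (filter (\<lambda>r. (r, c) \<in> frame lam) [0..<length lam])"

definition col_rearrangement :: "nat list \<Rightarrow> tableau \<Rightarrow> tableau \<Rightarrow> nat \<Rightarrow> nat \<Rightarrow> nat"
  where "col_rearrangement lam Tj Ts c =
    (let a = col_list lam Ts c; b = sort_key (row_index lam Tj) a
     in permutation_of_list (zip a b))"

definition collision :: "nat list \<Rightarrow> tableau \<Rightarrow> tableau \<Rightarrow> bool"
  where "collision lam Tj Ts \<longleftrightarrow>
    (\<exists>x y c r. x \<noteq> y \<and> x \<in> col_symbols lam Ts c \<and> y \<in> col_symbols lam Ts c \<and>
      x \<in> row_symbols lam Tj r \<and> y \<in> row_symbols lam Tj r)"

text \<open>
  The cycles of a permutation of a finite set (fixed points included) are its orbits.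
\<close>

definition cycle_defect :: "nat list \<Rightarrow> tableau \<Rightarrow> tableau \<Rightarrow> nat"
  where "cycle_defect lam Tj Ts =
    (\<Sum>c\<in>snd ` frame lam.
      \<Sum>C\<in>orbit (col_rearrangement lam Tj Ts c) ` col_symbols lam Ts c. card C - 1)"

definition procedure_output :: "nat list \<Rightarrow> tableau \<Rightarrow> tableau \<Rightarrow> (nat \<Rightarrow> nat) \<Rightarrow> int"
  where "procedure_output lam Tj Ti s =
    (let Ts = s \<circ> Ti in
     if collision lam Tj Ts then 0 else 1 - 2 * int (cycle_defect lam Tj Ts mod 2))"

end

theory Submission
  imports Defs
begin

text \<open>
  Write \<open>R\<close> for the row group of \<open>Tj\<close>, \<open>C\<close> for the column group of \<open>Ti\<close>, and \<open>\<sigma>\<close> for the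
  permutation carrying \<open>Ti\<close> to \<open>Tj\<close>. The coefficient of \<open>s\<close> is the sum of the signs of all \<open>v \<in> C\<close>
  with \<open>s v\<inverse> \<sigma>\<inverse> \<in> R\<close>. Put \<open>Ts = s Ti\<close> and \<open>w = s v\<inverse> s\<inverse>\<close>. Then \<open>w\<close> runs through the column group of
  \<open>Ts\<close> and has the sign of \<open>v\<close>; and since \<open>s v\<inverse> \<sigma>\<inverse>\<close> carries \<open>Tj\<close> to \<open>w Ts\<close>, it lies in \<open>R\<close> exactly
  if every row of \<open>w Ts\<close> consists of symbols of the same row of \<open>Tj\<close>. Call such \<open>w\<close> aligners; the
  coefficient is their signed count (\<open>p_elem_eq_sum_aligners\<close>).

  If there is an aligner \<open>w\<close>, the symbols of a column lie in different rows of \<open>w Ts\<close>, hence of \<open>Tj\<close>, so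
  a collision excludes aligners. Without a collision, a column of \<open>Ts\<close> and a row of \<open>Tj\<close> share at most one
  symbol, so there is at most one aligner. It exists because a column of \<open>Ts\<close> of height \<open>h\<close> then
  meets exactly the first \<open>h\<close> rows of \<open>Tj\<close>. This comes from counting (\<open>column_images_eq\<close>): a column of
  height \<open>h\<close> has at least \<open>h - k\<close> symbols in rows \<open>\<ge> k\<close> of \<open>Tj\<close>, and summed over all columns these lower
  bounds give precisely the number of boxes in rows \<open>\<ge> k\<close>, so that all of them are attained. Hence
  sorting a column by row index in \<open>Tj\<close> places each symbol in its own row, and the column
  rearrangements of the procedure glue to the aligner (\<open>column_sort_aligner\<close>).

  A cycle of length \<open>l\<close> is a product of \<open>l - 1\<close> transpositions, and the cycles of the glued permutation
  are those of the column rearrangements, so its sign is \<open>(-1) ^ k\<close> (\<open>sign_column_sort\<close>).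
\<close>

section \<open>The sign of a permutation in terms of its orbits\<close>

lemma cyclic_on_cycle_of_list:
  assumes "distinct cs" "cs \<noteq> []"
  shows "cyclic_on (cycle_of_list cs) (set cs)"
proof -
  let ?f = "cycle_of_list cs"
  have hd: "hd cs \<in> set cs" using assms by simp
  have "x \<in> orbit ?f (hd cs)" if "x \<in> set cs" for x
  proof -
    from that obtain k where k: "k < length cs" "x = cs ! k"
      by (auto simp: in_set_conv_nth)
    have "(?f ^^ k) (hd cs) = hd (map (?f ^^ k) cs)"
      using assms(2) by (simp add: hd_map)
    also have "\<dots> = hd (rotate k cs)"
      by (simp add: cyclic_rotation[OF assms(1)])
    also have "\<dots> = x"
      using k assms(2) by (simp add: hd_rotate_conv_nth)
    finally show ?thesis
      by (auto simp: orbit_altdef_permutation[OF permutation_of_cycle])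
  qed
  moreover have "orbit ?f (hd cs) \<subseteq> set cs"
    using permutes_orbit_subset[OF cycle_permutes hd] .
  ultimately have "set cs = orbit ?f (hd cs)" by blast
  with hd show ?thesis by (rule cyclic_on_singleI)
qed

lemma sign_cycle_of_list:
  "distinct cs \<Longrightarrow> sign (cycle_of_list cs) = (-1) ^ (length cs - 1)"
proof (induction cs rule: cycle_of_list.induct)
  case (1 i j cs)
  then show ?case
    by (simp add: sign_compose permutation_of_cycle permutation_swap_id sign_swap_id del: o_apply)
qed simp_all

text \<open>
  Induction over a decomposition into disjoint cycles: a new cycle is disjoint from the
  old permutation, so it adds its support as one orbit and leaves the other orbits unchanged.
\<close>

lemma sign_eq_orbits:
  assumes "p permutes A" "finite A"
  shows "sign p = (-1) ^ (\<Sum>C\<in>orbit p ` A. card C - 1)"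
proof -
  have "cycle_decomp A p" using assms by (rule cycle_decomposition)
  then have "p permutes A \<and> finite A \<and> sign p = (-1) ^ (\<Sum>C\<in>orbit p ` A. card C - 1)"
  proof induction
    case empty
    then show ?case by (simp add: permutes_id flip: id_def)
  next
    case (comp I p cs)
    let ?f = "cycle_of_list cs"
    have p: "p permutes I" "finite I" using comp by auto
    have perm: "permutation p" using p by (auto simp: permutation_permutes)
    have q: "(?f \<circ> p) permutes (set cs \<union> I)"
      by (meson cycle_permutes p(1) permutes_compose permutes_subset sup.cobounded1 sup.cobounded2)
    have old: "orbit (?f \<circ> p) x = orbit p x" if "x \<in> I" for x
    proof -
      have "cyclic_on (?f \<circ> p) (orbit p x)"
        using cycle_permutes cyclic_on_orbit[OF p] comp.hyps(3) permutes_orbit_subset[OF p(1) that]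
        by (rule permutes_comp_preserves_cyclic2)
      then show ?thesis
        by (rule orbit_cyclic_eq3) (rule permutation_self_in_orbit[OF perm])
    qed
    have new: "orbit (?f \<circ> p) x = set cs" if "x \<in> set cs" for x
    proof -
      have "cs \<noteq> []" using that by auto
      then have "cyclic_on (?f \<circ> p) (set cs)"
        using p(1) cyclic_on_cycle_of_list[OF comp.hyps(2)] comp.hyps(3)
        by (intro permutes_comp_preserves_cyclic1[of p I ?f "set cs" "set cs"]) auto
      then show ?thesis using that by (rule orbit_cyclic_eq3)
    qed
    have sgn: "sign (?f \<circ> p) = (-1) ^ (length cs - 1) * sign p"
      by (simp add: sign_compose perm permutation_of_cycle sign_cycle_of_list comp.hyps(2) del: o_apply)
    show ?case
    \<comment> \<open>an empty cycle is allowed in a decomposition, but adds no orbit\<close>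
    proof (cases "cs = []")
      case True
      then show ?thesis using comp by simp
    next
      case False
      have "orbit (?f \<circ> p) ` (set cs \<union> I) = insert (set cs) (orbit p ` I)"
      proof -
        have "orbit (?f \<circ> p) ` set cs = (\<lambda>_. set cs) ` set cs"
          using new by (rule image_cong[OF refl])
        moreover have "orbit (?f \<circ> p) ` I = orbit p ` I"
          using old by (rule image_cong[OF refl])
        ultimately show ?thesis using False by (simp add: image_Un image_constant_conv)
      qed
      moreover have "set cs \<notin> orbit p ` I"
      proof
        assume "set cs \<in> orbit p ` I"
        then have "set cs \<subseteq> I" using permutes_orbit_subset[OF p(1)] by blast
        then show False using False comp.hyps(3) by (simp add: Int_absorb2)
      qed
      ultimately have "(\<Sum>C\<in>orbit (?f \<circ> p) ` (set cs \<union> I). card C - 1)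
          = (length cs - 1) + (\<Sum>C\<in>orbit p ` I. card C - 1)"
        using p(2) comp.hyps(2) by (simp add: distinct_card)
      then show ?thesis using q sgn p(2) comp.IH by (simp add: power_add del: o_apply)
    qed
  qed
  then show ?thesis by blast
qed

section \<open>Convolution in the group algebra\<close>

lemma (in group) ga_mult_apply:
  assumes fin: "finite (carrier G)" and x: "x \<in> carrier G"
  shows "ga_mult G f g x = (\<Sum>v\<in>carrier G. f (x \<otimes> inv v) * g v)"
proof -
  have "ga_mult G f g x = (\<Sum>u\<in>carrier G. \<Sum>v\<in>carrier G. if u \<otimes> v = x then f u * g v else 0)"
    unfolding ga_mult_def by (intro sum.cong refl sum.inter_filter fin)
  also have "\<dots> = (\<Sum>v\<in>carrier G. \<Sum>u\<in>carrier G. if u \<otimes> v = x then f u * g v else 0)"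
    by (rule sum.swap)
  also have "\<dots> = (\<Sum>v\<in>carrier G. f (x \<otimes> inv v) * g v)"
  proof (rule sum.cong[OF refl])
    fix v assume v: "v \<in> carrier G"
    have "(\<Sum>u\<in>carrier G. if u \<otimes> v = x then f u * g v else 0)
        = (\<Sum>u\<in>carrier G. if u = x \<otimes> inv v then f u * g v else 0)"
      using v x by (intro sum.cong refl if_cong) (auto simp: m_assoc)
    also have "\<dots> = f (x \<otimes> inv v) * g v"
      using v x fin by (simp add: sum.delta)
    finally show "(\<Sum>u\<in>carrier G. if u \<otimes> v = x then f u * g v else 0) = f (x \<otimes> inv v) * g v" .
  qed
  finally show ?thesis .
qed

lemma finite_sym_group: "finite (carrier (sym_group n))"
  by (simp add: sym_group_def finite_permutations)

lemma sym_group_ga_mult_apply: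
  assumes "x \<in> carrier (sym_group n)"
  shows "ga_mult (sym_group n) f g x = (\<Sum>v\<in>carrier (sym_group n). f (x \<circ> inv' v) * g v)"
  unfolding group.ga_mult_apply[OF sym_group_is_group finite_sym_group assms]
  by (intro sum.cong refl) (simp add: sym_group_mult)

lemma mult_if_zero: "x * (if P then y else 0) = (if P then x * y else (0::'a::semiring_0))"
  by simp

lemma P_elem_apply: "P_elem n lam T s = (if s \<in> row_perms n lam T then 1 else 0)"
proof -
  have "finite (row_perms n lam T)"
    unfolding row_perms_def using finite_sym_group by simp
  then show ?thesis by (simp add: P_elem_def ga_of_def)
qed

lemma N_elem_apply: "N_elem n lam T s = (if s \<in> col_perms n lam T then of_int (sign s) else 0)"
proof -
  have "finite (col_perms n lam T)"
    unfolding col_perms_def using finite_sym_group by simp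
  then show ?thesis
    by (simp add: N_elem_def ga_of_def mult_if_zero)
qed

section \<open>Tableaux\<close>

lemma is_tableauD:
  assumes "is_tableau n lam T"
  shows "finite (frame lam)" and "inj_on T (frame lam)" and "T ` frame lam = {1..n}"
  using assms bij_betw_finite[of T "frame lam" "{1..n}"]
  unfolding is_tableau_def bij_betw_def by auto

lemma is_tableau_perm:
  assumes "is_tableau n lam T" "s permutes {1..n}"
  shows "is_tableau n lam (s \<circ> T)"
  using assms unfolding is_tableau_def
  by (blast intro: bij_betw_trans permutes_imp_bij)

lemma tableau_perm:
  assumes Ti: "is_tableau n lam Ti" and Tj: "is_tableau n lam Tj"
  shows "tableau_perm n lam Ti Tj permutes {1..n}"
    and "b \<in> frame lam \<Longrightarrow> tableau_perm n lam Ti Tj (Ti b) = Tj b"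
proof -
  let ?P = "\<lambda>p. p \<in> carrier (sym_group n) \<and> (\<forall>b\<in>frame lam. p (Ti b) = Tj b)"
  let ?q = "\<lambda>x. if x \<in> {1..n} then (Tj \<circ> inv_into (frame lam) Ti) x else x"
  have "bij_betw (Tj \<circ> inv_into (frame lam) Ti) {1..n} {1..n}"
    using Ti Tj unfolding is_tableau_def by (blast intro: bij_betw_trans bij_betw_inv_into)
  then have "bij_betw ?q {1..n} {1..n}" by (rule bij_betw_cong[THEN iffD1, rotated]) simp
  then have q: "?q permutes {1..n}" by (rule bij_imp_permutes) auto
  have "?P ?q"
    using q is_tableauD[OF Ti] by (auto simp: sym_group_carrier image_iff)
  moreover have "p = p'" if "?P p" "?P p'" for p p'
  proof
    fix x
    show "p x = p' x"
    proof (cases "x \<in> {1..n}")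
      case True
      then obtain b where "b \<in> frame lam" "x = Ti b" using is_tableauD(3)[OF Ti] by blast
      then show ?thesis using that by simp
    next
      case False
      then have "p x = x" "p' x = x"
        using that permutes_not_in unfolding sym_group_carrier by metis+
      then show ?thesis by simp
    qed
  qed
  ultimately have "\<exists>!p. ?P p" by blast
  then have "?P (tableau_perm n lam Ti Tj)"
    unfolding tableau_perm_def by (rule theI')
  then show "tableau_perm n lam Ti Tj permutes {1..n}"
    and "b \<in> frame lam \<Longrightarrow> tableau_perm n lam Ti Tj (Ti b) = Tj b"
    by (auto simp: sym_group_carrier)
qed

lemma finite_row_symbols:
  assumes "is_tableau n lam T" shows "finite (row_symbols lam T r)"
  by (rule finite_subset[of _ "T ` frame lam"])
    (use is_tableauD(1)[OF assms] in \<open>auto simp: row_symbols_def\<close>)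

lemma finite_col_symbols:
  assumes "is_tableau n lam T" shows "finite (col_symbols lam T c)"
  by (rule finite_subset[of _ "T ` frame lam"])
    (use is_tableauD(1)[OF assms] in \<open>auto simp: col_symbols_def\<close>)

lemma row_symbols_disjoint:
  assumes "is_tableau n lam T" "x \<in> row_symbols lam T r" "x \<in> row_symbols lam T r'"
  shows "r = r'"
  using assms(2,3) is_tableauD(2)[OF assms(1)]
  by (auto simp: row_symbols_def dest: inj_onD)

lemma col_symbols_disjoint:
  assumes "is_tableau n lam T" "x \<in> col_symbols lam T c" "x \<in> col_symbols lam T c'"
  shows "c = c'"
  using assms(2,3) is_tableauD(2)[OF assms(1)]
  by (auto simp: col_symbols_def dest: inj_onD)

lemma row_index_eq:
  assumes "is_tableau n lam T" "x \<in> row_symbols lam T r"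
  shows "row_index lam T x = r"
  unfolding row_index_def using assms(2) row_symbols_disjoint[OF assms(1)] by blast

lemma mem_row_symbols_row_index:
  assumes "is_tableau n lam T" "x \<in> {1..n}"
  shows "x \<in> row_symbols lam T (row_index lam T x)"
proof -
  obtain r c where "x = T (r, c)" "(r, c) \<in> frame lam"
    using is_tableauD(3)[OF assms(1)] assms(2) by (metis imageE prod.exhaust)
  then have "x \<in> row_symbols lam T r" by (auto simp: row_symbols_def)
  with row_index_eq[OF assms(1) this] show ?thesis by simp
qed

text \<open>
  Since rows are finite, a permutation that maps each row into itself maps it onto itself.
\<close>

lemma row_perms_iff:
  assumes T: "is_tableau n lam T" and p: "p permutes {1..n}"
  shows "p \<in> row_perms n lam T \<longleftrightarrow> (\<forall>r c. (r, c) \<in> frame lam \<longrightarrow> p (T (r, c)) \<in> row_symbols lam T r)"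
proof
  assume "p \<in> row_perms n lam T"
  then have "p ` row_symbols lam T r = row_symbols lam T r" for r
    by (simp add: row_perms_def)
  then show "\<forall>r c. (r, c) \<in> frame lam \<longrightarrow> p (T (r, c)) \<in> row_symbols lam T r"
    unfolding row_symbols_def by blast
next
  assume R: "\<forall>r c. (r, c) \<in> frame lam \<longrightarrow> p (T (r, c)) \<in> row_symbols lam T r"
  have "p ` row_symbols lam T r = row_symbols lam T r" for r
  proof (rule endo_inj_surj)
    show "finite (row_symbols lam T r)" by (rule finite_row_symbols[OF T])
    show "p ` row_symbols lam T r \<subseteq> row_symbols lam T r"
      using R by (auto simp: row_symbols_def)
    show "inj_on p (row_symbols lam T r)" by (rule permutes_inj_on[OF p])
  qed
  then show "p \<in> row_perms n lam T" using p by (simp add: row_perms_def sym_group_carrier)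
qed

section \<open>Coefficients as signed counts of aligning column permutations\<close>

definition aligners :: "nat \<Rightarrow> nat list \<Rightarrow> tableau \<Rightarrow> tableau \<Rightarrow> (nat \<Rightarrow> nat) set"
  where "aligners n lam Tj Ts = {w \<in> col_perms n lam Ts.
    \<forall>r c. (r, c) \<in> frame lam \<longrightarrow> w (Ts (r, c)) \<in> row_symbols lam Tj r}"

lemma image_inv_eq:
  assumes "p permutes S" "p ` A = A" shows "inv' p ` A = A"
  using assms by (metis image_inv_f_f permutes_inj)

lemma col_perms_conj:
  assumes s: "s permutes {1..n}" and v: "v \<in> col_perms n lam T"
  shows "s \<circ> inv' v \<circ> inv' s \<in> col_perms n lam (s \<circ> T)"
proof -
  have v': "v permutes {1..n}" and col: "\<And>c. v ` col_symbols lam T c = col_symbols lam T c"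
    using v by (auto simp: col_perms_def sym_group_carrier)
  have cs: "col_symbols lam (s \<circ> T) c = s ` col_symbols lam T c" for c
    by (auto simp: col_symbols_def)
  have "(s \<circ> inv' v \<circ> inv' s) ` col_symbols lam (s \<circ> T) c = col_symbols lam (s \<circ> T) c" for c
    unfolding cs image_comp[symmetric] image_inv_f_f[OF permutes_inj[OF s]]
      image_inv_eq[OF v' col] ..
  moreover have "s \<circ> inv' v \<circ> inv' s permutes {1..n}"
    using s v' by (intro permutes_compose permutes_inv)
  ultimately show ?thesis by (simp add: col_perms_def sym_group_carrier)
qed

text \<open>
  Conjugation turns the condition on the row factor into one about the two tableaux \<open>s \<circ> Ti\<close> and \<open>Tj\<close>
  alone, so that aligners can be studied for two arbitrary tableaux of the same shape.
\<close>

lemma p_elem_eq_sum_aligners: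
  assumes Ti: "is_tableau n lam Ti" and Tj: "is_tableau n lam Tj" and s: "s permutes {1..n}"
  shows "(p_elem n lam Tj Ti s :: 'a::field_char_0) =
    (\<Sum>w\<in>aligners n lam Tj (s \<circ> Ti). of_int (sign w))"
proof -
  let ?G = "carrier (sym_group n)"
  let ?t = "tableau_perm n lam Ti Tj"
  let ?V = "{v \<in> col_perms n lam Ti. s \<circ> inv' v \<circ> inv' ?t \<in> row_perms n lam Tj}"
  have t: "?t permutes {1..n}" and tT: "\<And>b. b \<in> frame lam \<Longrightarrow> ?t (Ti b) = Tj b"
    using tableau_perm[OF Ti Tj] by auto
  have colG: "col_perms n lam Ti \<subseteq> ?G" by (auto simp: col_perms_def)
  have left: "ga_mult (sym_group n) (P_elem n lam Tj) (ga_of ?t) u = P_elem n lam Tj (u \<circ> inv' ?t)"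
    if "u \<in> ?G" for u
    using t by (simp add: sym_group_ga_mult_apply[OF that] ga_of_def finite_sym_group
        sym_group_carrier mult_if_zero)
  have "(p_elem n lam Tj Ti s :: 'a) =
      (\<Sum>v\<in>?G. P_elem n lam Tj (s \<circ> inv' v \<circ> inv' ?t) * N_elem n lam Ti v)"
    unfolding p_elem_def sym_group_ga_mult_apply[OF s[folded sym_group_carrier]]
  proof (intro sum.cong refl arg_cong2[of _ _ _ _ "(*)"] left)
    fix v assume "v \<in> ?G"
    then show "s \<circ> inv' v \<in> ?G"
      using s unfolding sym_group_carrier by (intro permutes_compose permutes_inv)
  qed
  also have "\<dots> = (\<Sum>v\<in>?G. if v \<in> ?V then of_int (sign v) else 0)"
    by (intro sum.cong refl) (simp add: P_elem_apply N_elem_apply)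
  also have "\<dots> = (\<Sum>v\<in>?V. of_int (sign v))"
    using colG finite_sym_group by (subst sum.inter_restrict[symmetric]) (auto intro!: sum.cong)
  also have "\<dots> = (\<Sum>w\<in>aligners n lam Tj (s \<circ> Ti). of_int (sign w))"
  proof -
    \<comment> \<open>\<open>s \<circ> inv' v \<circ> inv' ?t\<close> is the row factor forced by the column factor \<open>v\<close>; it takes \<open>Tj b\<close> to \<open>s (inv' v (Ti b))\<close>\<close>
    have cond: "s \<circ> inv' v \<circ> inv' ?t \<in> row_perms n lam Tj \<longleftrightarrow>
        (\<forall>r c. (r, c) \<in> frame lam \<longrightarrow> (s \<circ> inv' v) (Ti (r, c)) \<in> row_symbols lam Tj r)"
      if "v permutes {1..n}" for v
    proof -
      have "inv' ?t (Tj b) = Ti b" if "b \<in> frame lam" for b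
        using tT[OF that] permutes_inverses(2)[OF t] by metis
      then show ?thesis
        using s t that by (subst row_perms_iff[OF Tj]) (auto intro!: permutes_compose permutes_inv)
    qed
    have conj_inv: "inv' (p \<circ> inv' q \<circ> inv' p) = p \<circ> q \<circ> inv' p"
      if p: "p permutes {1..n}" and q: "q permutes {1..n}" for p q
    proof (rule inv_equality)
      show "(p \<circ> q \<circ> inv' p) ((p \<circ> inv' q \<circ> inv' p) x) = x" for x
        using permutes_inverses[OF p] permutes_inverses[OF q] by simp
      show "(p \<circ> inv' q \<circ> inv' p) ((p \<circ> q \<circ> inv' p) x) = x" for x
        using permutes_inverses[OF p] permutes_inverses[OF q] by simp
    qed
    have inv2: "s \<circ> inv' (inv' s \<circ> inv' w \<circ> s) \<circ> inv' s = w" if "w permutes {1..n}" for w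
    proof -
      have "inv' (inv' s \<circ> inv' w \<circ> s) = inv' s \<circ> w \<circ> s"
        using conj_inv[OF permutes_inv[OF s] that] by (simp only: permutes_inv_inv[OF s])
      then show ?thesis using permutes_inverses[OF s] by (simp add: fun_eq_iff)
    qed
    have inv1: "inv' s \<circ> inv' (s \<circ> inv' v \<circ> inv' s) \<circ> s = v" if "v permutes {1..n}" for v
    proof -
      have "inv' (s \<circ> inv' v \<circ> inv' s) = s \<circ> v \<circ> inv' s"
        using conj_inv[OF s that] .
      then show ?thesis using permutes_inverses[OF s] by (simp add: fun_eq_iff)
    qed
    have sgn: "sign (s \<circ> inv' v \<circ> inv' s) = sign v" if "v permutes {1..n}" for v
    proof -
      have P: "permutation v" "permutation s"
        using s that by (auto intro: permutes_imp_permutation[of "{1..n}"])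
      then show ?thesis
        by (simp add: sign_compose sign_inverse permutation_compose permutation_inverse del: o_apply)
    qed
    have colp: "v permutes {1..n}" if "v \<in> col_perms n lam T" for v T
      using that by (simp add: col_perms_def sym_group_carrier)
    have sTi: "inv' s \<circ> (s \<circ> Ti) = Ti"
      using permutes_inverses[OF s] by (simp add: fun_eq_iff)
    show ?thesis
    proof (rule sum.reindex_bij_witness[where i = "\<lambda>w. inv' s \<circ> inv' w \<circ> s"
          and j = "\<lambda>v. s \<circ> inv' v \<circ> inv' s"])
      fix v assume v: "v \<in> ?V"
      then have vp: "v permutes {1..n}" using colp by blast
      show "inv' s \<circ> inv' (s \<circ> inv' v \<circ> inv' s) \<circ> s = v" by (rule inv1[OF vp])
      show "s \<circ> inv' v \<circ> inv' s \<in> aligners n lam Tj (s \<circ> Ti)"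
        using v cond[OF vp] col_perms_conj[OF s] permutes_inverses[OF s]
        by (simp add: aligners_def)
      show "(of_int (sign (s \<circ> inv' v \<circ> inv' s)) :: 'a) = of_int (sign v)"
        by (simp only: sgn[OF vp])
    next
      fix w assume w: "w \<in> aligners n lam Tj (s \<circ> Ti)"
      then have wc: "w \<in> col_perms n lam (s \<circ> Ti)" by (simp add: aligners_def)
      then have wp: "w permutes {1..n}" using colp by blast
      show eq: "s \<circ> inv' (inv' s \<circ> inv' w \<circ> s) \<circ> inv' s = w" by (rule inv2[OF wp])
      have mem: "inv' s \<circ> inv' w \<circ> s \<in> col_perms n lam Ti"
        using col_perms_conj[OF permutes_inv[OF s] wc] unfolding sTi permutes_inv_inv[OF s] .
      have "(s \<circ> inv' (inv' s \<circ> inv' w \<circ> s)) (Ti b) = w ((s \<circ> Ti) b)" for b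
        using fun_cong[OF eq, of "s (Ti b)"] permutes_inverses[OF s] by simp
      then show "inv' s \<circ> inv' w \<circ> s \<in> ?V"
        using w mem cond[OF colp[OF mem]] by (simp add: aligners_def)
    qed
  qed
  finally show ?thesis .
qed

lemma aligners_empty_if_collision:
  assumes Ts: "is_tableau n lam Ts" and Tj: "is_tableau n lam Tj" and "collision lam Tj Ts"
  shows "aligners n lam Tj Ts = {}"
proof (rule ccontr)
  assume "aligners n lam Tj Ts \<noteq> {}"
  then obtain w where w: "w \<in> aligners n lam Tj Ts" by blast
  have col: "w ` col_symbols lam Ts c = col_symbols lam Ts c" for c
    using w by (simp add: aligners_def col_perms_def)
  have row: "w (Ts (r, c)) \<in> row_symbols lam Tj r" if "(r, c) \<in> frame lam" for r c
    using w that by (simp add: aligners_def)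
  \<comment> \<open>in \<open>w Ts\<close> each symbol stands in its column of \<open>Ts\<close> and in its row of \<open>Tj\<close>, so these two determine it\<close>
  have pre: "\<exists>b. b = (r, c) \<and> b \<in> frame lam \<and> x = w (Ts b)"
    if x: "x \<in> col_symbols lam Ts c" and r: "x \<in> row_symbols lam Tj r" for x r c
  proof -
    from x obtain y where "y \<in> col_symbols lam Ts c" "x = w y" using col by blast
    then obtain r' where r': "(r', c) \<in> frame lam" "x = w (Ts (r', c))"
      by (auto simp: col_symbols_def)
    with row have "r' = r" using row_symbols_disjoint[OF Tj _ r] by blast
    with r' show ?thesis by blast
  qed
  from assms(3) show False unfolding collision_def using pre by blast
qed

text \<open>
  The image of the symbol in box \<open>(r, c)\<close> lies in column \<open>c\<close> of \<open>Ts\<close> and row \<open>r\<close> of \<open>Tj\<close>, and without a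
  collision these two sets share at most one symbol.
\<close>

lemma aligners_unique:
  assumes Ts: "is_tableau n lam Ts" and nc: "\<not> collision lam Tj Ts"
    and w: "w \<in> aligners n lam Tj Ts" and w': "w' \<in> aligners n lam Tj Ts"
  shows "w = w'"
proof
  fix x
  have inC: "u (Ts (r, c)) \<in> col_symbols lam Ts c"
    if "u \<in> aligners n lam Tj Ts" "(r, c) \<in> frame lam" for u r c
  proof -
    have "Ts (r, c) \<in> col_symbols lam Ts c" using that(2) by (auto simp: col_symbols_def)
    then show ?thesis using that(1) by (auto simp: aligners_def col_perms_def)
  qed
  show "w x = w' x"
  proof (cases "x \<in> {1..n}")
    case True
    then obtain r c where "(r, c) \<in> frame lam" "x = Ts (r, c)"
      using is_tableauD(3)[OF Ts] by (metis imageE prod.exhaust)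
    then show ?thesis
      using nc w w' inC unfolding collision_def aligners_def by blast
  next
    case False
    moreover have "w permutes {1..n}" "w' permutes {1..n}"
      using w w' by (simp_all add: aligners_def col_perms_def sym_group_carrier)
    ultimately show ?thesis using permutes_not_in by metis
  qed
qed

section \<open>Existence of an aligning column permutation\<close>

text \<open>
  The counting argument behind existence, for a labelling \<open>g\<close> of the boxes of a diagram by row
  numbers. A column of height \<open>h\<close> with distinct labels has at least \<open>h - k\<close> labels \<open>\<ge> k\<close>, with equality
  for the labelling by actual rows. As the totals agree, equality holds in every column, and
  \<open>k = h\<close> shows that the labels of a column of height \<open>h\<close> are all \<open>< h\<close>.
\<close>

lemma column_images_eq:
  fixes g :: "nat \<times> nat \<Rightarrow> nat"
  assumes fin: "finite F"
    and down: "\<And>r r' c. (r, c) \<in> F \<Longrightarrow> r' < r \<Longrightarrow> (r', c) \<in> F"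
    and inj: "\<And>c. inj_on (\<lambda>r. g (r, c)) {r. (r, c) \<in> F}"
    and count: "\<And>k. card {b \<in> F. k \<le> g b} = card {b \<in> F. k \<le> fst b}"
  shows "(\<lambda>r. g (r, c)) ` {r. (r, c) \<in> F} = {r. (r, c) \<in> F}"
proof -
  define R where "R c = {r. (r, c) \<in> F}" for c
  define A where "A c = (\<lambda>r. g (r, c)) ` R c" for c
  have finR: "finite (R c)" for c
    unfolding R_def by (rule finite_subset[of _ "fst ` F"]) (use fin in force)+
  have finA: "finite (A c)" for c using finR by (simp add: A_def)
  have cardA: "card (A c) = card (R c)" for c
    unfolding A_def R_def by (rule card_image[OF inj])
  have Rint: "R c = {..<card (R c)}" for c
  proof -
    have "{..<card (R c)} \<subseteq> R c"
    proof
      fix k assume k: "k \<in> {..<card (R c)}"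
      show "k \<in> R c"
      proof (rule ccontr)
        assume "k \<notin> R c"
        have "r < k" if "r \<in> R c" for r
        proof (rule ccontr)
          assume "\<not> r < k"
          with that \<open>k \<notin> R c\<close> have "k < r" by (cases "k = r") auto
          with that down[of r c k] \<open>k \<notin> R c\<close> show False by (simp add: R_def)
        qed
        then have "R c \<subseteq> {..<k}" by blast
        then have "card (R c) \<le> k" using card_mono[of "{..<k}" "R c"] by simp
        with k show False by simp
      qed
    qed
    then show ?thesis using card_subset_eq[OF finR, of "{..<card (R c)}" c] by simp
  qed
  have split: "card {b \<in> F. k \<le> h b} = (\<Sum>c\<in>snd ` F. card {r \<in> R c. k \<le> h (r, c)})"
    for h :: "nat \<times> nat \<Rightarrow> nat" and k
  proof -
    have "{b \<in> F. k \<le> h b} = (\<Union>c\<in>snd ` F. (\<lambda>r. (r, c)) ` {r \<in> R c. k \<le> h (r, c)})"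
      unfolding R_def by (auto simp: image_iff Bex_def)
    also have "card \<dots> = (\<Sum>c\<in>snd ` F. card ((\<lambda>r. (r, c)) ` {r \<in> R c. k \<le> h (r, c)}))"
      using fin finR by (intro card_UN_disjoint) auto
    also have "\<dots> = (\<Sum>c\<in>snd ` F. card {r \<in> R c. k \<le> h (r, c)})"
      by (intro sum.cong refl card_image inj_onI) simp
    finally show ?thesis .
  qed
  have cntA: "card {r \<in> R c. k \<le> g (r, c)} = card (A c - {..<k})" for k c
  proof -
    have "A c - {..<k} = (\<lambda>r. g (r, c)) ` {r \<in> R c. k \<le> g (r, c)}" unfolding A_def by auto
    moreover have "inj_on (\<lambda>r. g (r, c)) {r \<in> R c. k \<le> g (r, c)}"
      by (rule inj_on_subset[OF inj]) (auto simp: R_def)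
    ultimately show ?thesis by (simp add: card_image)
  qed
  have cntR: "card {r \<in> R c. k \<le> r} = card (R c - {..<k})" for k c
    by (rule arg_cong[of _ _ card]) auto
  have le: "card (R c - {..<k}) \<le> card (A c - {..<k})" for k c
  proof -
    have "card (R c - {..<k}) = card (R c) - k"
      by (subst (1) Rint) (simp add: lessThan_minus_lessThan)
    also have "\<dots> \<le> card (A c - {..<k})"
      using diff_card_le_card_Diff[of "{..<k}" "A c"] cardA by simp
    finally show ?thesis .
  qed
  have "(\<Sum>c\<in>snd ` F. card (A c - {..<k})) = (\<Sum>c\<in>snd ` F. card (R c - {..<k}))" for k
    using count[of k] unfolding split by (simp add: cntA cntR)
  then have eq: "card (A c - {..<k}) = card (R c - {..<k})" if "c \<in> snd ` F" for c k
    using sum_mono_inv[of "\<lambda>c. card (R c - {..<k})" "snd ` F" "\<lambda>c. card (A c - {..<k})"] le that fin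
    by (metis finite_imageI)
  have "A c = R c"
  proof (cases "c \<in> snd ` F")
    case True
    have "card (A c - {..<card (R c)}) = 0"
      unfolding eq[OF True] using Rint[of c] by simp
    then have "A c \<subseteq> R c" using finA Rint[of c] by simp
    then show ?thesis using card_subset_eq[OF finR] cardA by blast
  next
    case False
    then have "R c = {}" by (force simp: R_def)
    then show ?thesis by (simp add: A_def)
  qed
  then show ?thesis unfolding A_def R_def .
qed

lemma frame_down_closed:
  assumes "is_partition lam n" "(r, c) \<in> frame lam" "r' < r"
  shows "(r', c) \<in> frame lam"
proof -
  have "lam ! r \<le> lam ! r'"
    using assms by (auto simp: is_partition_def frame_def sorted_wrt_iff_nth_less)
  then show ?thesis using assms(2,3) by (auto simp: frame_def)
qed

lemma row_index_inj_on_col: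
  assumes Ts: "is_tableau n lam Ts" and Tj: "is_tableau n lam Tj" and nc: "\<not> collision lam Tj Ts"
  shows "inj_on (row_index lam Tj) (col_symbols lam Ts c)"
proof (rule inj_onI)
  fix x y
  assume x: "x \<in> col_symbols lam Ts c" and y: "y \<in> col_symbols lam Ts c"
    and eq: "row_index lam Tj x = row_index lam Tj y"
  have "x \<in> {1..n}" "y \<in> {1..n}"
    using x y is_tableauD(3)[OF Ts] by (auto simp: col_symbols_def)
  then have "x \<in> row_symbols lam Tj (row_index lam Tj x)" "y \<in> row_symbols lam Tj (row_index lam Tj x)"
    using mem_row_symbols_row_index[OF Tj] eq by metis+
  then show "x = y" using x y nc unfolding collision_def by blast
qed

text \<open>
  The counts required by \<open>column_images_eq\<close> agree because both equal the number of symbols in rows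
  \<open>\<ge> k\<close> of \<open>Tj\<close>: one is taken through the bijection \<open>Ts\<close>, the other through \<open>Tj\<close>.
\<close>

lemma row_index_image_col:
  assumes lam: "is_partition lam n" and Ts: "is_tableau n lam Ts" and Tj: "is_tableau n lam Tj"
    and nc: "\<not> collision lam Tj Ts"
  shows "row_index lam Tj ` col_symbols lam Ts c = {r. (r, c) \<in> frame lam}"
proof -
  let ?g = "\<lambda>b. row_index lam Tj (Ts b)"
  have "(\<lambda>r. ?g (r, c)) ` {r. (r, c) \<in> frame lam} = {r. (r, c) \<in> frame lam}"
  proof (rule column_images_eq)
    show "finite (frame lam)" by (rule is_tableauD(1)[OF Ts])
    show "(r', c) \<in> frame lam" if "(r, c) \<in> frame lam" "r' < r" for r r' c
      using lam that by (rule frame_down_closed)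
    show "inj_on (\<lambda>r. ?g (r, c)) {r. (r, c) \<in> frame lam}" for c
    proof (rule inj_onI)
      fix r r' assume *: "r \<in> {r. (r, c) \<in> frame lam}" "r' \<in> {r. (r, c) \<in> frame lam}"
        "?g (r, c) = ?g (r', c)"
      then have "Ts (r, c) = Ts (r', c)"
        by (intro inj_onD[OF row_index_inj_on_col[OF Ts Tj nc, of c] *(3)])
          (auto simp: col_symbols_def)
      with * show "r = r'" using is_tableauD(2)[OF Ts] by (auto dest: inj_onD)
    qed
    show "card {b \<in> frame lam. k \<le> ?g b} = card {b \<in> frame lam. k \<le> fst b}" for k
    proof -
      let ?S = "{x \<in> {1..n}. k \<le> row_index lam Tj x}"
      have count: "card {b \<in> frame lam. k \<le> row_index lam Tj (T b)} = card ?S"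
        if T: "is_tableau n lam T" for T
      proof -
        have "?S = T ` {b \<in> frame lam. k \<le> row_index lam Tj (T b)}"
          unfolding is_tableauD(3)[OF T, symmetric] by auto
        moreover have "inj_on T {b \<in> frame lam. k \<le> row_index lam Tj (T b)}"
          by (rule inj_on_subset[OF is_tableauD(2)[OF T]]) auto
        ultimately show ?thesis by (simp add: card_image)
      qed
      have "row_index lam Tj (Tj b) = fst b" if "b \<in> frame lam" for b
        using that by (intro row_index_eq[OF Tj]) (cases b, auto simp: row_symbols_def)
      then have "{b \<in> frame lam. k \<le> row_index lam Tj (Tj b)} = {b \<in> frame lam. k \<le> fst b}"
        by auto
      then show ?thesis using count[OF Ts] count[OF Tj] by simp
    qed
  qed
  moreover have "col_symbols lam Ts c = (\<lambda>r. Ts (r, c)) ` {r. (r, c) \<in> frame lam}"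
    by (auto simp: col_symbols_def)
  ultimately show ?thesis by (simp add: image_image)
qed

text \<open>
  The row indices of the sorted column form the increasing list of the row numbers of the column,
  with no gap, so the sorted symbol at position \<open>r\<close> lies in row \<open>r\<close> of \<open>Tj\<close>.
\<close>

lemma col_rearrangement_aligns:
  assumes lam: "is_partition lam n" and Ts: "is_tableau n lam Ts" and Tj: "is_tableau n lam Tj"
    and nc: "\<not> collision lam Tj Ts"
  shows "col_rearrangement lam Tj Ts c permutes col_symbols lam Ts c"
    and "(r, c) \<in> frame lam \<Longrightarrow> col_rearrangement lam Tj Ts c (Ts (r, c)) \<in> row_symbols lam Tj r"
proof -
  let ?idx = "row_index lam Tj"
  define rows where "rows = filter (\<lambda>r. (r, c) \<in> frame lam) [0..<length lam]"
  define a where "a = map (\<lambda>r. Ts (r, c)) rows"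
  define b where "b = sort_key ?idx a"
  have f: "col_rearrangement lam Tj Ts c = permutation_of_list (zip a b)"
    by (simp add: col_rearrangement_def col_list_def a_def b_def rows_def Let_def)
  have set_rows: "set rows = {r. (r, c) \<in> frame lam}"
    by (auto simp: rows_def frame_def)
  have rows: "sorted rows" "distinct rows" by (simp_all add: rows_def sorted_wrt_filter)
  have set_a: "set a = col_symbols lam Ts c"
    by (auto simp: a_def set_rows col_symbols_def)
  have dist_a: "distinct a"
    unfolding a_def distinct_map using rows is_tableauD(2)[OF Ts]
    by (auto simp: set_rows inj_on_def)
  have b: "set b = set a" "distinct b" "length b = length a"
    using dist_a by (simp_all add: b_def)
  have idx_b: "map ?idx b = rows"
  proof (rule sorted_distinct_set_unique)
    show "sorted (map ?idx b)" by (simp add: b_def)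
    show "distinct (map ?idx b)"
      using b row_index_inj_on_col[OF Ts Tj nc, of c] by (simp add: distinct_map set_a)
    show "set (map ?idx b) = set rows"
      using row_index_image_col[OF lam Ts Tj nc, of c] by (simp add: b set_a set_rows)
  qed (use rows in auto)
  have lp: "list_permutes (zip a b) (col_symbols lam Ts c)"
    using b dist_a set_a by (intro list_permutesI) auto
  then show "col_rearrangement lam Tj Ts c permutes col_symbols lam Ts c"
    unfolding f by (rule permutation_of_list_permutes)
  assume "(r, c) \<in> frame lam"
  then obtain i where i: "i < length rows" "rows ! i = r"
    by (metis in_set_conv_nth mem_Collect_eq set_rows)
  have len: "i < length a" "i < length b" using i b by (simp_all add: a_def)
  have "(Ts (r, c), b ! i) \<in> set (zip a b)"
    using i len unfolding in_set_zip by (intro exI[of _ i]) (simp add: a_def)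
  with lp have fx: "col_rearrangement lam Tj Ts c (Ts (r, c)) = b ! i"
    unfolding f by (rule permutation_of_list_unique)
  have "b ! i \<in> {1..n}"
    using nth_mem[OF len(2)] b(1) set_a is_tableauD(3)[OF Ts] by (auto simp: col_symbols_def)
  then have "b ! i \<in> row_symbols lam Tj (?idx (b ! i))"
    by (rule mem_row_symbols_row_index[OF Tj])
  moreover have "?idx (b ! i) = r" using idx_b i len nth_map by metis
  ultimately show "col_rearrangement lam Tj Ts c (Ts (r, c)) \<in> row_symbols lam Tj r"
    by (simp add: fx)
qed

definition column_sort :: "nat list \<Rightarrow> tableau \<Rightarrow> tableau \<Rightarrow> nat \<Rightarrow> nat"
  where "column_sort lam Tj Ts x =
    (if x \<in> Ts ` frame lam
     then col_rearrangement lam Tj Ts (snd (inv_into (frame lam) Ts x)) x else x)"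

lemma column_sort_eq:
  assumes Ts: "is_tableau n lam Ts" and x: "x \<in> col_symbols lam Ts c"
  shows "column_sort lam Tj Ts x = col_rearrangement lam Tj Ts c x"
proof -
  obtain r where r: "(r, c) \<in> frame lam" "x = Ts (r, c)"
    using x by (auto simp: col_symbols_def)
  then have "inv_into (frame lam) Ts x = (r, c)"
    using is_tableauD(2)[OF Ts] by simp
  with r show ?thesis by (simp add: column_sort_def)
qed

lemma column_sort_aligner:
  assumes lam: "is_partition lam n" and Ts: "is_tableau n lam Ts" and Tj: "is_tableau n lam Tj"
    and nc: "\<not> collision lam Tj Ts"
  shows "column_sort lam Tj Ts \<in> aligners n lam Tj Ts"
proof -
  let ?w = "column_sort lam Tj Ts"
  note f = col_rearrangement_aligns[OF lam Ts Tj nc]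
  have cols: "{1..n} = (\<Union>c. col_symbols lam Ts c)"
    unfolding is_tableauD(3)[OF Ts, symmetric] by (force simp: col_symbols_def)
  have img: "?w ` col_symbols lam Ts c = col_symbols lam Ts c" for c
    using column_sort_eq[OF Ts] permutes_image[OF f(1)] by (metis (no_types, lifting) image_cong)
  have "?w ` {1..n} = {1..n}" unfolding cols image_UN img ..
  then have "bij_betw ?w {1..n} {1..n}"
    by (simp add: bij_betw_def eq_card_imp_inj_on)
  then have "?w permutes {1..n}"
    by (rule bij_imp_permutes)
      (simp add: column_sort_def is_tableauD(3)[OF Ts] del: atLeastAtMost_iff)
  moreover have "?w (Ts (r, c)) \<in> row_symbols lam Tj r" if "(r, c) \<in> frame lam" for r c
  proof -
    have "Ts (r, c) \<in> col_symbols lam Ts c" using that by (auto simp: col_symbols_def)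
    then show ?thesis using f(2)[OF that] by (simp add: column_sort_eq[OF Ts])
  qed
  ultimately show ?thesis
    using img by (simp add: aligners_def col_perms_def sym_group_carrier)
qed

text \<open>
  On each column the glued permutation agrees with the rearrangement of that column, hence has the
  same orbits there; orbits from different columns are disjoint and nonempty, so no orbit is counted
  twice.
\<close>

lemma sign_column_sort:
  assumes lam: "is_partition lam n" and Ts: "is_tableau n lam Ts" and Tj: "is_tableau n lam Tj"
    and nc: "\<not> collision lam Tj Ts"
  shows "sign (column_sort lam Tj Ts) = (-1) ^ cycle_defect lam Tj Ts"
proof -
  let ?w = "column_sort lam Tj Ts" and ?K = "snd ` frame lam"
  let ?f = "col_rearrangement lam Tj Ts" and ?C = "col_symbols lam Ts"
  have w: "?w permutes {1..n}"
    using column_sort_aligner[OF assms] by (simp add: aligners_def col_perms_def sym_group_carrier)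
  have f: "?f c permutes ?C c" for c by (rule col_rearrangement_aligns(1)[OF assms])
  have fin: "finite (?C c)" for c by (rule finite_col_symbols[OF Ts])
  have cols: "{1..n} = (\<Union>c\<in>?K. ?C c)"
    unfolding is_tableauD(3)[OF Ts, symmetric] by (force simp: col_symbols_def)
  have orb: "orbit ?w x = orbit (?f c) x" if "x \<in> ?C c" for x c
    by (rule orbit_cong0[OF that, symmetric])
      (use permutes_in_image[OF f] column_sort_eq[OF Ts] in auto)
  have "orbit ?w ` {1..n} = (\<Union>c\<in>?K. orbit (?f c) ` ?C c)"
    unfolding cols image_UN using orb by (intro SUP_cong refl image_cong) auto
  then have "(\<Sum>C\<in>orbit ?w ` {1..n}. card C - 1)
      = (\<Sum>C\<in>(\<Union>c\<in>?K. orbit (?f c) ` ?C c). card C - 1)" by simp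
  also have "\<dots> = cycle_defect lam Tj Ts"
    unfolding cycle_defect_def
  proof (rule sum.UNION_disjoint)
    show "finite ?K" using is_tableauD(1)[OF Ts] by simp
    show "\<forall>c\<in>?K. finite (orbit (?f c) ` ?C c)" using fin by simp
    show "\<forall>c\<in>?K. \<forall>c'\<in>?K. c \<noteq> c' \<longrightarrow> orbit (?f c) ` ?C c \<inter> orbit (?f c') ` ?C c' = {}"
    proof (intro ballI impI equals0I)
      fix c c' D assume "c \<noteq> c'" "D \<in> orbit (?f c) ` ?C c \<inter> orbit (?f c') ` ?C c'"
      then have "D \<subseteq> ?C c" "D \<subseteq> ?C c'" "D \<noteq> {}"
        using permutes_orbit_subset[OF f] by (auto simp: orbit_nonempty)
      with \<open>c \<noteq> c'\<close> show False using col_symbols_disjoint[OF Ts] by blast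
    qed
  qed
  finally show ?thesis using sign_eq_orbits[OF w] by simp
qed

section \<open>The procedure computes the coefficient\<close>

theorem mainTheorem3:
  fixes n :: nat and lam :: "nat list" and Ti Tj :: tableau and s :: "nat \<Rightarrow> nat"
  assumes "n \<ge> 1"
    and "is_partition lam n"
    and "standard_tableau n lam Ti"
    and "standard_tableau n lam Tj"
    and "s \<in> carrier (sym_group n)"
  shows "(p_elem n lam Tj Ti s :: 'a::field_char_0) = of_int (procedure_output lam Tj Ti s)"
proof -
  have Ti: "is_tableau n lam Ti" and Tj: "is_tableau n lam Tj"
    using assms(3,4) by (auto simp: standard_tableau_def)
  have s: "s permutes {1..n}" using assms(5) by (simp add: sym_group_carrier)
  let ?Ts = "s \<circ> Ti"
  have Ts: "is_tableau n lam ?Ts" by (rule is_tableau_perm[OF Ti s])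
  note coeff = p_elem_eq_sum_aligners[OF Ti Tj s, where 'a = 'a]
  show ?thesis
  proof (cases "collision lam Tj ?Ts")
    case True
    then show ?thesis
      unfolding coeff aligners_empty_if_collision[OF Ts Tj True] procedure_output_def Let_def
      by simp
  next
    case False
    let ?w = "column_sort lam Tj ?Ts" and ?k = "cycle_defect lam Tj ?Ts"
    have "aligners n lam Tj ?Ts = {?w}"
      using column_sort_aligner[OF assms(2) Ts Tj False] aligners_unique[OF Ts False] by blast
    moreover have "(-1::int) ^ ?k = 1 - 2 * int (?k mod 2)"
      by (cases "even ?k") (simp_all add: odd_iff_mod_2_eq_one)
    ultimately show ?thesis
      unfolding coeff procedure_output_def Let_def
      using False sign_column_sort[OF assms(2) Ts Tj False] by simp
  qed
qed

end
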